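(* Every measurable relation algebra that is completely representable has a scaffold.
   Context: **Relation algebras.** A relation algebra is an algebra $\mathfrak A=(A,+,-,;,{}^{\smile},1')$ such that $(A,+,-)$ is a Boolean algebra and for all $r,s,t$: $r;(s;t)=(r;s);t$, $r;1'=r$, $r^{\smile\smile}=r$, $(r;s)^\smile=s^\smile;r^\smile$, $(r+s);t=r;t+s;t$, $(r+s)^\smile=r^\smile+s^\smile$, $r^\smile;-(r;s)+-s=-s$. Order, $0$, $1$, suprema, atoms refer to the Boolean part. A function is an element $f$ with $f^\smile;f\le 1'$. A subidentity atom is an atom $x\le 1'$; it is measurable if $x;1;x$ is the sum (supremum) of a set of functions. A relation algebra is measurable if $1'$ is the sum of a set of measurable atoms. **Complete representations.** A complete representation of a relation algebra $\mathfrak A$ is an embedding $\vartheta$ of $\mathfrak A$ into the set relation algebra of all subrelations of some equivalence relation $E$ on a set $U$ (operations: union, complement relative to $E$, relational composition, relational converse, and the identity relation $id_U$; the unit is $E$) that preserves all existing suprema as unions: whenever $a=\sum X$ exists in $\mathfrak A$, $\vartheta(a)=\bigcup\{\vartheta(b):b\in X\}$. $\mathfrak A$ is completely representable if it has a complete representation. **Scaffolds.** In a measurable relation algebra let $I$ be the set of measurable atoms and $\mathcal E=\{(x,y)\in I\times I: x;1;y\neq0\}$ (an equivalence relation on $I$). A scaffold is a system $\langle a_{xy}:(x,y)\in\mathcal E\rangle$ of atoms with $a_{xy}\le x;1;y$, $a_{xx}=x$, $a_{yx}=a_{xy}^\smile$ for all $x\in I$, $(x,y)\in\mathcal E$, and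 $a_{xz}\le a_{xy};a_{yz}$ for all $(x,y),(y,z)\in\mathcal E$. *)

theory Defs
  imports Main "HOL-Library.Lub_Glb"
begin

(* The Boolean operations +, -, 0, 1 of a relation algebra are sup, uminus, bot, top of the
   Boolean algebra class; the one-element algebra (bot = top) is allowed. *)
class relation_algebra = boolean_algebra +
  fixes rcomp :: "'a \<Rightarrow> 'a \<Rightarrow> 'a"  (infixl "\<Zcomp>" 75)
    and rconv :: "'a \<Rightarrow> 'a"  ("(_\<^sup>\<smile>)" [1000] 999)
    and rid :: "'a"  ("1''")
  assumes rcomp_assoc: "r \<Zcomp> (s \<Zcomp> t) = (r \<Zcomp> s) \<Zcomp> t"
    and rcomp_rid: "r \<Zcomp> 1' = r"
    and rconv_rconv: "(r\<^sup>\<smile>)\<^sup>\<smile> = r"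
    and rconv_rcomp: "(r \<Zcomp> s)\<^sup>\<smile> = s\<^sup>\<smile> \<Zcomp> r\<^sup>\<smile>"
    and sup_rcomp: "sup r s \<Zcomp> t = sup (r \<Zcomp> t) (s \<Zcomp> t)"
    and rconv_sup: "(sup r s)\<^sup>\<smile> = sup (r\<^sup>\<smile>) (s\<^sup>\<smile>)"
    and tarski_law: "sup (r\<^sup>\<smile> \<Zcomp> (- (r \<Zcomp> s))) (- s) = - s"

definition is_sum :: "'a::order set \<Rightarrow> 'a \<Rightarrow> bool"
  where "is_sum X a \<longleftrightarrow> isLub UNIV X a"

definition atom :: "'a::boolean_algebra \<Rightarrow> bool"
  where "atom a \<longleftrightarrow> a \<noteq> bot \<and> (\<forall>b. b \<le> a \<longrightarrow> b = bot \<or> b = a)"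

definition functional :: "'a::relation_algebra \<Rightarrow> bool"
  where "functional f \<longleftrightarrow> f\<^sup>\<smile> \<Zcomp> f \<le> 1'"

definition subid_atom :: "'a::relation_algebra \<Rightarrow> bool"
  where "subid_atom x \<longleftrightarrow> atom x \<and> x \<le> 1'"

definition measurable_atom :: "'a::relation_algebra \<Rightarrow> bool"
  where "measurable_atom x \<longleftrightarrow>
    subid_atom x \<and> (\<exists>F. (\<forall>f\<in>F. functional f) \<and> is_sum F (x \<Zcomp> top \<Zcomp> x))"

definition measurable_algebra :: "'a::relation_algebra itself \<Rightarrow> bool"
  where "measurable_algebra _ \<longleftrightarrow>
    (\<exists>X :: 'a set. (\<forall>x\<in>X. measurable_atom x) \<and> is_sum X 1')"

definition set_representation ::
    "'u set \<Rightarrow> ('u \<times> 'u) set \<Rightarrow> ('a::relation_algebra \<Rightarrow> ('u \<times> 'u) set) \<Rightarrow> bool"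
  where "set_representation U E \<theta> \<longleftrightarrow>
    equiv U E \<and> range \<theta> \<subseteq> Pow E \<and> inj \<theta> \<and>
    (\<forall>r s. \<theta> (sup r s) = \<theta> r \<union> \<theta> s) \<and>
    (\<forall>r. \<theta> (- r) = E - \<theta> r) \<and>
    \<theta> top = E \<and>
    (\<forall>r s. \<theta> (r \<Zcomp> s) = \<theta> r O \<theta> s) \<and>
    (\<forall>r. \<theta> (r\<^sup>\<smile>) = (\<theta> r)\<inverse>) \<and>
    \<theta> 1' = Id_on U"

definition complete_representation ::
    "'u set \<Rightarrow> ('u \<times> 'u) set \<Rightarrow> ('a::relation_algebra \<Rightarrow> ('u \<times> 'u) set) \<Rightarrow> bool"
  where "complete_representation U E \<theta> \<longleftrightarrow>
    set_representation U E \<theta> \<and> (\<forall>X a. is_sum X a \<longrightarrow> \<theta> a = (\<Union>b\<in>X. \<theta> b))"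

(* HOL cannot quantify over types inside a formula, so the type 'u from which the base set U
   is taken is a parameter; as a free type variable in a hypothesis it ranges over all types. *)
definition completely_representable :: "'a::relation_algebra itself \<Rightarrow> 'u itself \<Rightarrow> bool"
  where "completely_representable _ _ \<longleftrightarrow>
    (\<exists>(U :: 'u set) E (\<theta> :: 'a \<Rightarrow> ('u \<times> 'u) set). complete_representation U E \<theta>)"

definition atom_equiv :: "('a::relation_algebra \<times> 'a) set"
  where "atom_equiv = {(x, y). measurable_atom x \<and> measurable_atom y \<and> x \<Zcomp> top \<Zcomp> y \<noteq> bot}"

(* A system indexed by atom_equiv is a binary function whose values outside atom_equiv are
   irrelevant. *)
definition scaffold :: "('a::relation_algebra \<Rightarrow> 'a \<Rightarrow> 'a) \<Rightarrow> bool"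
  where "scaffold a \<longleftrightarrow>
    (\<forall>(x, y)\<in>atom_equiv. atom (a x y) \<and> a x y \<le> x \<Zcomp> top \<Zcomp> y) \<and>
    (\<forall>x. measurable_atom x \<longrightarrow> a x x = x) \<and>
    (\<forall>(x, y)\<in>atom_equiv. a y x = (a x y)\<^sup>\<smile>) \<and>
    (\<forall>x y z. (x, y) \<in> atom_equiv \<and> (y, z) \<in> atom_equiv \<longrightarrow> a x z \<le> a x y \<Zcomp> a y z)"

end

theory Submission
  imports Defs
begin

text \<open>In a complete representation every pair of points in the unit lies in the image of a unique
  atom: otherwise the elements whose image omits the pair would have supremum \<open>1\<close>, and completeness
  would be violated. If \<open>x;1;y \<noteq> 0\<close>, then every point of the atom \<open>x\<close> is equivalent to some point
  of \<open>y\<close>, so one can pick a point \<open>u x\<close> for each measurable atom such that equivalent atoms receive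
  equivalent points. The atoms containing the pairs \<open>(u x, u y)\<close> then form a scaffold.\<close>

lemma rconv_mono:
  fixes r s :: "'a::relation_algebra"
  assumes "r \<le> s"
  shows "r\<^sup>\<smile> \<le> s\<^sup>\<smile>"
  using assms by (metis rconv_sup le_iff_sup)

context
  fixes U :: "'u set" and E and \<theta> :: "'a::relation_algebra \<Rightarrow> ('u \<times> 'u) set"
  assumes rep: "set_representation U E \<theta>"
begin

lemma
  shows rep_equiv: "equiv U E"
    and rep_inj: "inj \<theta>"
    and rep_sup: "\<theta> (sup r s) = \<theta> r \<union> \<theta> s"
    and rep_compl: "\<theta> (- r) = E - \<theta> r"
    and rep_top: "\<theta> top = E"
    and rep_rcomp: "\<theta> (r \<Zcomp> s) = \<theta> r O \<theta> s"
    and rep_rconv: "\<theta> (r\<^sup>\<smile>) = (\<theta> r)\<inverse>"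
    and rep_rid: "\<theta> 1' = Id_on U"
  using rep by (auto simp: set_representation_def)

lemma rep_subset: "\<theta> r \<subseteq> E"
  using rep by (auto simp: set_representation_def)

lemma rep_bot: "\<theta> bot = {}"
  using rep_compl[of top] rep_top by simp

lemma rep_eq_empty_iff: "\<theta> r = {} \<longleftrightarrow> r = bot"
  using rep_bot rep_inj by (metis injD)

lemma rep_inf: "\<theta> (inf r s) = \<theta> r \<inter> \<theta> s"
proof -
  have "inf r s = - sup (- r) (- s)" by simp
  then have "\<theta> (inf r s) = E - ((E - \<theta> r) \<union> (E - \<theta> s))"
    by (simp only: rep_compl rep_sup)
  then show ?thesis using rep_subset by blast
qed

lemma rep_mono: "r \<le> s \<Longrightarrow> \<theta> r \<subseteq> \<theta> s"
  by (metis rep_sup le_iff_sup sup_ge1)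

lemma rep_subid: "subid_atom x \<Longrightarrow> \<theta> x \<subseteq> Id_on U"
  using rep_mono[of x "1'"] rep_rid by (simp add: subid_atom_def)

lemma rep_subid_atom_point:
  assumes "subid_atom x"
  obtains v where "(v, v) \<in> \<theta> x"
proof -
  have "\<theta> x \<noteq> {}"
    using assms rep_eq_empty_iff by (auto simp: subid_atom_def atom_def)
  then show thesis using that rep_subid[OF assms] by blast
qed

text \<open>Injectivity makes nonzero elements exactly those with nonempty image. The images of
  \<open>x\<close> and \<open>y\<close> lie on the diagonal, so a pair in the image of the product
  is just an edge of \<open>E\<close> from a point of \<open>x\<close> to a point of
  \<open>y\<close>.\<close>

lemma rep_sandwich_ne_bot_iff:
  assumes "subid_atom x" "subid_atom y"
  shows "x \<Zcomp> top \<Zcomp> y \<noteq> bot \<longleftrightarrow>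
    (\<exists>p q. (p, p) \<in> \<theta> x \<and> (p, q) \<in> E \<and> (q, q) \<in> \<theta> y)"
proof -
  have "x \<Zcomp> top \<Zcomp> y \<noteq> bot \<longleftrightarrow> \<theta> x O E O \<theta> y \<noteq> {}"
    using rep_eq_empty_iff[of "x \<Zcomp> top \<Zcomp> y"] by (simp add: rep_rcomp rep_top O_assoc)
  then show ?thesis
    using assms[THEN rep_subid] by blast
qed

text \<open>An atom lies below \<open>top \<Zcomp> y \<Zcomp> top\<close> as soon as it meets it.
  Hence if one point of \<open>x\<close> is equivalent to a point of \<open>y\<close>, every point
  of \<open>x\<close> is.\<close>

lemma rep_related_point:
  assumes x: "subid_atom x" and y: "subid_atom y" and ne: "x \<Zcomp> top \<Zcomp> y \<noteq> bot"
    and v: "(v, v) \<in> \<theta> x"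
  obtains w where "(v, w) \<in> E" "(w, w) \<in> \<theta> y"
proof -
  obtain p q where pq: "(p, p) \<in> \<theta> x" "(p, q) \<in> E" "(q, q) \<in> \<theta> y"
    using ne rep_sandwich_ne_bot_iff[OF x y] by blast
  then have "(q, p) \<in> E"
    using rep_equiv by (meson equiv_def symD)
  \<comment> \<open>The path from \<open>p\<close> to \<open>q\<close>, through the loop at
    \<open>q\<close>, and back to \<open>p\<close> witnesses the membership.\<close>
  then have "(p, p) \<in> \<theta> (inf x (top \<Zcomp> y \<Zcomp> top))"
    using pq by (auto simp: rep_inf rep_rcomp rep_top)
  then have "inf x (top \<Zcomp> y \<Zcomp> top) \<noteq> bot"
    using rep_bot by auto
  then have "inf x (top \<Zcomp> y \<Zcomp> top) = x"
    using x inf.cobounded1 unfolding subid_atom_def atom_def by blast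
  then have "(v, v) \<in> \<theta> (top \<Zcomp> y \<Zcomp> top)"
    using v by (metis rep_inf IntD2)
  then obtain w w' where "(v, w) \<in> E" "(w, w') \<in> \<theta> y"
    by (auto simp: rep_rcomp rep_top)
  then show thesis using that rep_subid[OF y] by blast
qed

text \<open>The atom is the complement of an upper bound of all elements whose images omit
  \<open>p\<close>. Leastness among the elements whose images contain \<open>p\<close> reduces later
  inequalities to membership of a pair.\<close>

lemma complete_rep_least:
  assumes sums: "\<And>X a. is_sum X a \<Longrightarrow> \<theta> a = (\<Union>b\<in>X. \<theta> b)" and p: "p \<in> E"
  obtains b where "atom b" "p \<in> \<theta> b" "\<And>c. p \<in> \<theta> c \<Longrightarrow> b \<le> c"
proof -
  \<comment> \<open>Were \<open>top\<close> the sum, completeness would put \<open>p\<close> into a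
    union of sets that all omit it.\<close>
  have "\<not> is_sum {c. p \<notin> \<theta> c} top"
    using sums[of "{c. p \<notin> \<theta> c}" top] p rep_top by auto
  then obtain d where d: "\<And>c. p \<notin> \<theta> c \<Longrightarrow> c \<le> d" "d \<noteq> top"
    by (auto simp: is_sum_def isLub_def isUb_def leastP_def setle_def setge_def top_unique)
  have least: "- d \<le> c" if "p \<in> \<theta> c" for c
    using d(1)[of "- c"] that compl_le_swap2 by (auto simp: rep_compl)
  have ne: "- d \<noteq> bot"
    using d(2) by (metis double_compl compl_bot_eq)
  \<comment> \<open>Otherwise \<open>- d\<close> would itself be among the elements bounded by
    \<open>d\<close>, forcing \<open>d\<close> to be \<open>top\<close>.\<close>
  have mem: "p \<in> \<theta> (- d)"
  proof (rule ccontr)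
    assume "p \<notin> \<theta> (- d)"
    then have "- d \<le> d" by (rule d(1))
    then show False using d(2) by (metis compl_sup_top sup_absorb2)
  qed
  have "c = bot \<or> c = - d" if "c \<le> - d" for c
  proof (cases "p \<in> \<theta> c")
    case True
    then show ?thesis using least that antisym by blast
  next
    case False
    then have "c \<le> d" by (rule d(1))
    then show ?thesis using that by (metis inf.bounded_iff compl_inf_bot bot_unique inf_commute)
  qed
  then show thesis using that ne mem least by (auto simp: atom_def)
qed

lemma rep_related_points:
  obtains u where "\<And>x. subid_atom x \<Longrightarrow> (u x, u x) \<in> \<theta> x"
    "\<And>x y. subid_atom x \<Longrightarrow> subid_atom y \<Longrightarrow> x \<Zcomp> top \<Zcomp> y \<noteq> bot \<Longrightarrow> (u x, u y) \<in> E"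
proof -
  \<comment> \<open>\<open>T x\<close> is the union of the \<open>E\<close>-classes that contain a
    point of \<open>x\<close>. The choice \<open>q x\<close> depends on this set alone, so atoms
    with the same \<open>T\<close> share a base point; \<open>u x\<close> is then a point of
    \<open>x\<close> in the class of that base point.\<close>
  define T where "T x = {w. \<exists>v. (w, v) \<in> E \<and> (v, v) \<in> \<theta> x}" for x
  define q where "q x = (SOME w. w \<in> T x)" for x
  define u where "u x = (SOME v. (q x, v) \<in> E \<and> (v, v) \<in> \<theta> x)" for x
  have sym: "(b, a) \<in> E" if "(a, b) \<in> E" for a b
    using rep_equiv that by (meson equiv_def symD)
  have trans: "(a, c) \<in> E" if "(a, b) \<in> E" "(b, c) \<in> E" for a b c
    using rep_equiv that by (meson equiv_def transD)
  have u: "(q x, u x) \<in> E \<and> (u x, u x) \<in> \<theta> x" if x: "subid_atom x" for x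
  proof -
    obtain v where "(v, v) \<in> \<theta> x" using rep_subid_atom_point[OF x] .
    then have "v \<in> T x" using rep_subset by (auto simp: T_def)
    then have "q x \<in> T x" unfolding q_def by (rule someI)
    then have "\<exists>v. (q x, v) \<in> E \<and> (v, v) \<in> \<theta> x" by (simp add: T_def)
    then show ?thesis unfolding u_def by (rule someI_ex)
  qed
  have "(u x, u y) \<in> E"
    if x: "subid_atom x" and y: "subid_atom y" and ne: "x \<Zcomp> top \<Zcomp> y \<noteq> bot" for x y
  proof -
    have ne': "y \<Zcomp> top \<Zcomp> x \<noteq> bot"
      using ne rep_sandwich_ne_bot_iff x y sym by metis
    have sub: "T a \<subseteq> T b"
      if ab: "subid_atom a" "subid_atom b" "a \<Zcomp> top \<Zcomp> b \<noteq> bot" for a b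
    proof
      fix w assume "w \<in> T a"
      then obtain v where v: "(w, v) \<in> E" "(v, v) \<in> \<theta> a" by (auto simp: T_def)
      obtain v' where "(v, v') \<in> E" "(v', v') \<in> \<theta> b"
        using rep_related_point[OF ab v(2)] .
      then show "w \<in> T b" using trans[OF v(1)] by (auto simp: T_def)
    qed
    have "T x = T y"
      using sub[OF x y ne] sub[OF y x ne'] by (rule antisym)
    then have "q x = q y" by (simp add: q_def)
    then show ?thesis using u[OF x] u[OF y] sym trans by metis
  qed
  then show thesis using that u by blast
qed

end

theorem theorem7p6:
  assumes "measurable_algebra TYPE('a::relation_algebra)"
    and "completely_representable TYPE('a) TYPE('u)"
  shows "\<exists>a :: 'a \<Rightarrow> 'a \<Rightarrow> 'a. scaffold a"
proof -
  obtain U :: "'u set" and E and \<theta> :: "'a \<Rightarrow> ('u \<times> 'u) set"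
    where rep: "set_representation U E \<theta>"
      and sums: "\<And>X a. is_sum X a \<Longrightarrow> \<theta> a = (\<Union>b\<in>X. \<theta> b)"
    using assms(2) by (auto simp: completely_representable_def complete_representation_def)
  obtain u where u: "\<And>x. subid_atom x \<Longrightarrow> (u x, u x) \<in> \<theta> x"
    and uE: "\<And>x y. subid_atom x \<Longrightarrow> subid_atom y \<Longrightarrow> x \<Zcomp> top \<Zcomp> y \<noteq> bot \<Longrightarrow> (u x, u y) \<in> E"
    using rep_related_points[OF rep] by metis
  have "\<exists>b. atom b \<and> p \<in> \<theta> b \<and> (\<forall>c. p \<in> \<theta> c \<longrightarrow> b \<le> c)" if "p \<in> E" for p
    using complete_rep_least[OF rep sums that] by metis
  then obtain A where A: "\<And>p. p \<in> E \<Longrightarrow> atom (A p)" "\<And>p. p \<in> E \<Longrightarrow> p \<in> \<theta> (A p)"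
    and least: "\<And>p c. p \<in> E \<Longrightarrow> p \<in> \<theta> c \<Longrightarrow> A p \<le> c"
    by metis
  define a where "a x y = A (u x, u y)" for x y
  have ae: "subid_atom x" "subid_atom y" "(u x, u y) \<in> E" "(u y, u x) \<in> E"
    if "(x, y) \<in> atom_equiv" for x y
  proof -
    show "subid_atom x" "subid_atom y" and E: "(u x, u y) \<in> E"
      using that uE by (auto simp: atom_equiv_def measurable_atom_def)
    show "(u y, u x) \<in> E"
      using E rep_equiv[OF rep] by (meson equiv_def symD)
  qed
  have "atom (a x y) \<and> a x y \<le> x \<Zcomp> top \<Zcomp> y" if xy: "(x, y) \<in> atom_equiv" for x y
  proof
    show "atom (a x y)" using A(1) ae(3)[OF xy] by (simp add: a_def)
    have "(u x, u y) \<in> \<theta> (x \<Zcomp> top \<Zcomp> y)"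
      using u[OF ae(1)[OF xy]] u[OF ae(2)[OF xy]] ae(3)[OF xy]
      by (auto simp: rep_rcomp[OF rep] rep_top[OF rep])
    then show "a x y \<le> x \<Zcomp> top \<Zcomp> y" using least ae(3)[OF xy] by (simp add: a_def)
  qed
  moreover have "a x x = x" if "measurable_atom x" for x
  proof -
    have x: "subid_atom x" using that by (simp add: measurable_atom_def)
    have E: "(u x, u x) \<in> E" using u[OF x] rep_subset[OF rep] by blast
    \<comment> \<open>As \<open>x\<close> is an atom, a nonzero element below it must equal
      it.\<close>
    have "a x x \<le> x" "a x x \<noteq> bot"
      using least[OF E u[OF x]] A(1)[OF E] by (auto simp: a_def atom_def)
    then show ?thesis using x by (auto simp: subid_atom_def atom_def)
  qed
  moreover have "a y x = (a x y)\<^sup>\<smile>" if xy: "(x, y) \<in> atom_equiv" for x y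
  proof (rule antisym)
    show "a y x \<le> (a x y)\<^sup>\<smile>"
      using least[OF ae(4)[OF xy]] A(2)[OF ae(3)[OF xy]] by (simp add: a_def rep_rconv[OF rep])
    \<comment> \<open>The other inclusion comes from the mirrored inequality by taking
      converses.\<close>
    have "a x y \<le> (a y x)\<^sup>\<smile>"
      using least[OF ae(3)[OF xy]] A(2)[OF ae(4)[OF xy]] by (simp add: a_def rep_rconv[OF rep])
    then show "(a x y)\<^sup>\<smile> \<le> a y x" by (metis rconv_mono rconv_rconv)
  qed
  moreover have "a x z \<le> a x y \<Zcomp> a y z"
    if xy: "(x, y) \<in> atom_equiv" and yz: "(y, z) \<in> atom_equiv" for x y z
  proof -
    have "(u x, u z) \<in> \<theta> (a x y \<Zcomp> a y z)"
      using A(2)[OF ae(3)[OF xy]] A(2)[OF ae(3)[OF yz]] by (auto simp: a_def rep_rcomp[OF rep])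
    \<comment> \<open>Membership in an image also places the pair \<open>(u x, u z)\<close> in
      \<open>E\<close>, so leastness of its atom applies.\<close>
    then show ?thesis using least rep_subset[OF rep] unfolding a_def by blast
  qed
  ultimately have "scaffold a" unfolding scaffold_def by blast
  then show ?thesis by blast
qed

end
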